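(* Let $A\in\mathcal B(L^2(B))$ be self-adjoint and satisfy $m(A\otimes A)m^*=A$ and $(1\otimes\eta^*m)(1\otimes A\otimes1)(m^*\eta\otimes1)=A$. Then $A$ commutes with both the modular operator $\nabla$ and the modular conjugation $J$.
   Context: $B$ is a finite-dimensional $C^*$-algebra, $\mathrm{Tr}$ the sum of the non-normalised traces of its matrix blocks, $\psi$ a faithful state on $B$, $Q\in B$ the positive invertible element with $\psi(a)=\mathrm{Tr}(Qa)$, and $\sigma_z(a)=Q^{iz}aQ^{-iz}$ for $z\in\mathbb C$, $a\in B$. $L^2(B)$ is the GNS space of $\psi$ with GNS map $\Lambda:B\to L^2(B)$ (a linear bijection), $(\Lambda(a)|\Lambda(b))=\psi(a^*b)$ (linear in the right variable); $m:L^2(B)\otimes L^2(B)\to L^2(B)$ is $m(\Lambda(a)\otimes\Lambda(b))=\Lambda(ab)$ with Hilbert space adjoint $m^*$; $\eta:\mathbb C\to L^2(B)$, $\lambda\mapsto\lambda\Lambda(1)$, with adjoint $\eta^*$. The modular operator is $\nabla\Lambda(a)=\Lambda(\sigma_{-i}(a))=\Lambda(QaQ^{-1})$, and the modular conjugation is the antilinear map $J\Lambda(a)=\Lambda(\sigma_{i/2}(a)^* )$. *)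

theory Defs
  imports
    "HOL-Analysis.Complex_Transcendental"
    "HOL-Computational_Algebra.Polynomial"
    "HOL-Library.FuncSet"
    "Jordan_Normal_Form.Matrix"
begin

class scaleC =
  fixes scaleC :: "complex \<Rightarrow> 'a \<Rightarrow> 'a" (infixr "*\<^sub>C" 75)

class complex_vector = ab_group_add + scaleC +
  assumes scaleC_add_right: "c *\<^sub>C (x + y) = c *\<^sub>C x + c *\<^sub>C y"
    and scaleC_add_left: "(c + d) *\<^sub>C x = c *\<^sub>C x + d *\<^sub>C x"
    and scaleC_scaleC: "c *\<^sub>C d *\<^sub>C x = (c * d) *\<^sub>C x"
    and scaleC_one: "1 *\<^sub>C x = x"

abbreviation clinear :: "('a::complex_vector \<Rightarrow> 'b::complex_vector) \<Rightarrow> bool" where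
  "clinear \<equiv> Vector_Spaces.linear scaleC scaleC"

global_interpretation complex_vector: vector_space "scaleC :: complex \<Rightarrow> 'a \<Rightarrow> 'a::complex_vector"
  by unfold_locales
    (simp_all add: scaleC_add_right scaleC_add_left scaleC_scaleC scaleC_one)

text \<open>The inner product is conjugate linear in the left and linear in the right variable.
  Completeness is not required: all spaces below are finite-dimensional, hence complete.\<close>

class complex_inner = complex_vector +
  fixes cinner :: "'a \<Rightarrow> 'a \<Rightarrow> complex"
  assumes cinner_commute: "cinner x y = cnj (cinner y x)"
    and cinner_add_right: "cinner x (y + z) = cinner x y + cinner x z"
    and cinner_scaleC_right: "cinner x (c *\<^sub>C y) = c * cinner x y"
    and cinner_ge_zero: "0 \<le> Re (cinner x x)"
    and cinner_eq_zero_iff: "cinner x x = 0 \<longleftrightarrow> x = 0"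

instantiation complex :: complex_inner
begin

definition scaleC_complex :: "complex \<Rightarrow> complex \<Rightarrow> complex" where
  "scaleC_complex c x = c * x"

definition cinner_complex :: "complex \<Rightarrow> complex \<Rightarrow> complex" where
  "cinner_complex x y = cnj x * y"

instance
  by standard (auto simp: scaleC_complex_def cinner_complex_def algebra_simps)

end

text \<open>Like \<^const>\<open>adjoint\<close> for real inner products. The adjoint of a linear map between
  finite-dimensional spaces exists and is unique.\<close>

definition cadjoint :: "('a::complex_inner \<Rightarrow> 'b::complex_inner) \<Rightarrow> 'b \<Rightarrow> 'a" where
  "cadjoint F = (SOME G. \<forall>x y. cinner (F x) y = cinner x (G y))"

text \<open>\<^term>\<open>hilbert_tensor t\<close> says that the space \<^typ>\<open>'c\<close>, with elementary
  tensors \<^term>\<open>t x y\<close>, is a (finite-dimensional) Hilbert space tensor product of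
  \<^typ>\<open>'a\<close> and \<^typ>\<open>'b\<close>; this determines \<^typ>\<open>'c\<close> and \<^term>\<open>t\<close> up to a
  unique unitary. The linear span needs no closure in finite dimension, and scalars are
  absorbed into the elementary tensors. Scalar multiplication makes any space a tensor
  product of itself with \<^typ>\<open>complex\<close>, on either side.\<close>

definition hilbert_tensor ::
    "('a::complex_inner \<Rightarrow> 'b::complex_inner \<Rightarrow> 'c::complex_inner) \<Rightarrow> bool" where
  "hilbert_tensor t \<longleftrightarrow>
     (\<forall>x. clinear (t x)) \<and> (\<forall>y. clinear (\<lambda>x. t x y)) \<and>
     (\<forall>x y x' y'. cinner (t x y) (t x' y') = cinner x x' * cinner y y') \<and>
     (\<forall>z. \<exists>(N::nat) x y. z = (\<Sum>i<N. t (x i) (y i)))"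

definition tensor_op ::
    "('a \<Rightarrow> 'b \<Rightarrow> 'c::complex_inner) \<Rightarrow> ('d \<Rightarrow> 'e \<Rightarrow> 'f::complex_inner) \<Rightarrow>
     ('a::complex_inner \<Rightarrow> 'd::complex_inner) \<Rightarrow> ('b::complex_inner \<Rightarrow> 'e::complex_inner) \<Rightarrow>
     'c \<Rightarrow> 'f" where
  "tensor_op t t' F G = (THE T. clinear T \<and> (\<forall>x y. T (t x y) = t' (F x) (G y)))"

text \<open>The class \<^class>\<open>real_normed_algebra_1\<close> only excludes the zero algebra, which has no
  states; nonzero finite-dimensional C*-algebras are unital and their unit has norm one.\<close>

class fd_cstar_algebra = complex_vector + real_normed_algebra_1 + banach +
  fixes star :: "'a \<Rightarrow> 'a"
  assumes scaleR_eq_scaleC: "scaleR r x = scaleC (complex_of_real r) x"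
    and mult_scaleC_left: "(c *\<^sub>C x) * y = c *\<^sub>C (x * y)"
    and mult_scaleC_right: "x * (c *\<^sub>C y) = c *\<^sub>C (x * y)"
    and norm_scaleC: "norm (c *\<^sub>C x) = cmod c * norm x"
    and star_star: "star (star x) = x"
    and star_add: "star (x + y) = star x + star y"
    and star_scaleC: "star (c *\<^sub>C x) = cnj c *\<^sub>C star x"
    and star_mult: "star (x * y) = star y * star x"
    and cstar_identity: "norm (star x * x) = (norm x)\<^sup>2"
    and finite_dimensional: "\<exists>S. finite S \<and> (\<forall>x. \<exists>c. x = (\<Sum>s\<in>S. c s *\<^sub>C s))"

text \<open>The data \<^term>\<open>r\<close>, \<^term>\<open>n\<close>, \<^term>\<open>\<Phi>\<close> identify the algebra with the direct sum of its
  matrix blocks. Preservation of the unit follows from bijectivity.\<close>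

definition matrix_blocks ::
    "nat \<Rightarrow> (nat \<Rightarrow> nat) \<Rightarrow> ('b::fd_cstar_algebra \<Rightarrow> nat \<Rightarrow> complex mat) \<Rightarrow> bool" where
  "matrix_blocks r n \<Phi> \<longleftrightarrow>
     (\<forall>k<r. 0 < n k) \<and>
     bij_betw \<Phi> UNIV (\<Pi>\<^sub>E k\<in>{..<r}. carrier_mat (n k) (n k)) \<and>
     (\<forall>k<r. \<forall>a b. \<Phi> (a + b) k = \<Phi> a k + \<Phi> b k) \<and>
     (\<forall>k<r. \<forall>c a. \<Phi> (c *\<^sub>C a) k = c \<cdot>\<^sub>m \<Phi> a k) \<and>
     (\<forall>k<r. \<forall>a b. \<Phi> (a * b) k = \<Phi> a k * \<Phi> b k) \<and>
     (\<forall>k<r. \<forall>a. \<Phi> (star a) k = transpose_mat (map_mat cnj (\<Phi> a k)))"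

definition block_trace ::
    "nat \<Rightarrow> (nat \<Rightarrow> nat) \<Rightarrow> ('b \<Rightarrow> nat \<Rightarrow> complex mat) \<Rightarrow> 'b \<Rightarrow> complex" where
  "block_trace r n \<Phi> a = (\<Sum>k<r. \<Sum>i<n k. \<Phi> a k $$ (i, i))"

definition faithful_state :: "('b::fd_cstar_algebra \<Rightarrow> complex) \<Rightarrow> bool" where
  "faithful_state \<psi> \<longleftrightarrow>
     clinear \<psi> \<and>
     (\<forall>a. \<psi> (star a * a) \<in> \<real> \<and> 0 \<le> Re (\<psi> (star a * a))) \<and>
     \<psi> 1 = 1 \<and>
     (\<forall>a. \<psi> (star a * a) = 0 \<longrightarrow> a = 0)"

definition positive_element :: "'b::fd_cstar_algebra \<Rightarrow> bool" where
  "positive_element a \<longleftrightarrow> (\<exists>b. a = star b * b)"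

definition invertible_element :: "'b::fd_cstar_algebra \<Rightarrow> bool" where
  "invertible_element a \<longleftrightarrow> (\<exists>b. a * b = 1 \<and> b * a = 1)"

definition algebra_spectrum :: "'b::fd_cstar_algebra \<Rightarrow> complex set" where
  "algebra_spectrum a = {z. \<not> invertible_element (a - z *\<^sub>C 1)}"

definition poly_apply :: "complex poly \<Rightarrow> 'b::fd_cstar_algebra \<Rightarrow> 'b" where
  "poly_apply p a = (\<Sum>i\<le>degree p. coeff p i *\<^sub>C a ^ i)"

definition lagrange_poly :: "complex set \<Rightarrow> (complex \<Rightarrow> complex) \<Rightarrow> complex poly" where
  "lagrange_poly S f =
     (\<Sum>z\<in>S. Polynomial.smult (f z) (\<Prod>u\<in>S - {z}. Polynomial.smult (1 / (z - u)) [:- u, 1:]))"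

text \<open>A normal element of a finite-dimensional C*-algebra has finite spectrum and is the sum of
  its eigenvalues times its spectral projections, which are the values at the element of the
  Lagrange basis polynomials of the spectrum. So this is the usual functional calculus.\<close>

definition functional_calculus ::
    "(complex \<Rightarrow> complex) \<Rightarrow> 'b::fd_cstar_algebra \<Rightarrow> 'b" where
  "functional_calculus f a = poly_apply (lagrange_poly (algebra_spectrum a) f) a"

text \<open>Only used for positive invertible \<^term>\<open>a\<close>, whose spectrum consists of positive reals,
  so that the choice of branch in \<^term>\<open>z powr w\<close> is immaterial.\<close>

definition element_cpow :: "'b::fd_cstar_algebra \<Rightarrow> complex \<Rightarrow> 'b" where
  "element_cpow a w = functional_calculus (\<lambda>z. z powr w) a"

definition sigma :: "'b::fd_cstar_algebra \<Rightarrow> complex \<Rightarrow> 'b \<Rightarrow> 'b" where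
  "sigma Q z a = element_cpow Q (\<i> * z) * a * element_cpow Q (- (\<i> * z))"

definition gns_map ::
    "('b::fd_cstar_algebra \<Rightarrow> complex) \<Rightarrow> ('b \<Rightarrow> 'h::complex_inner) \<Rightarrow> bool" where
  "gns_map \<psi> \<Lambda> \<longleftrightarrow>
     clinear \<Lambda> \<and> bij \<Lambda> \<and> (\<forall>a b. cinner (\<Lambda> a) (\<Lambda> b) = \<psi> (star a * b))"

definition gns_mult ::
    "('h \<Rightarrow> 'h \<Rightarrow> 'h2::complex_inner) \<Rightarrow> ('b::fd_cstar_algebra \<Rightarrow> 'h::complex_inner) \<Rightarrow>
     'h2 \<Rightarrow> 'h" where
  "gns_mult t \<Lambda> = (THE m. clinear m \<and> (\<forall>a b. m (t (\<Lambda> a) (\<Lambda> b)) = \<Lambda> (a * b)))"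

definition gns_unit :: "('b::fd_cstar_algebra \<Rightarrow> 'h::complex_inner) \<Rightarrow> complex \<Rightarrow> 'h" where
  "gns_unit \<Lambda> c = c *\<^sub>C \<Lambda> 1"

definition modular_operator ::
    "'b::fd_cstar_algebra \<Rightarrow> ('b \<Rightarrow> 'h::complex_inner) \<Rightarrow> 'h \<Rightarrow> 'h" where
  "modular_operator Q \<Lambda> \<xi> = \<Lambda> (sigma Q (- \<i>) (inv_into UNIV \<Lambda> \<xi>))"

definition modular_conjugation ::
    "'b::fd_cstar_algebra \<Rightarrow> ('b \<Rightarrow> 'h::complex_inner) \<Rightarrow> 'h \<Rightarrow> 'h" where
  "modular_conjugation Q \<Lambda> \<xi> = \<Lambda> (star (sigma Q (\<i> / 2) (inv_into UNIV \<Lambda> \<xi>)))"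

end

theory Submission
  imports Defs "HOL-Computational_Algebra.Fundamental_Theorem_Algebra"
begin

text \<open>Let \<open>C\<close> be the map on \<open>B\<close> corresponding to \<open>A\<close>. The undirectedness equation together with
  \<open>A = A\<^sup>*\<close> and the KMS condition says that \<open>C\<close> commutes with the antilinear involution
  \<open>T x = Q x\<^sup>* Q\<^sup>-\<^sup>1\<close>. Its adjoint for the GNS inner product is \<open>x \<mapsto> x\<^sup>*\<close>, so \<open>C\<close> preserves the
  involution and commutes with the composition of the two, which is \<open>\<nabla>\<close>. Since \<open>Q\<close> is diagonalisable with
  positive eigenvalues, \<open>\<sigma>\<^bsub>i/2\<^esub>\<close> is a polynomial in \<open>\<nabla>\<close>, hence \<open>C\<close> commutes with it, and \<open>A\<close> with \<open>J\<close>.\<close>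

section \<open>Complex-linear maps and the inner product\<close>

lemma clinearI:
  assumes "\<And>x y. f (x + y) = f x + f y" and "\<And>c x. f (c *\<^sub>C x) = c *\<^sub>C f x"
  shows "clinear f"
  by unfold_locales (use assms in auto)

lemma clinear_add: "clinear f \<Longrightarrow> f (x + y) = f x + f y"
  by (simp add: linear_iff_module_hom module_hom.add)

lemma clinear_scaleC: "clinear f \<Longrightarrow> f (c *\<^sub>C x) = c *\<^sub>C f x"
  by (simp add: linear_iff_module_hom module_hom.scale)

lemma clinear_sum: "clinear f \<Longrightarrow> f (\<Sum>i\<in>I. x i) = (\<Sum>i\<in>I. f (x i))"
  by (simp add: linear_iff_module_hom module_hom.sum)

lemma clinear_zero: "clinear f \<Longrightarrow> f 0 = 0"
  by (simp add: linear_iff_module_hom module_hom.zero)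

lemma clinear_id: "clinear id"
  by (rule clinearI) auto

lemma clinear_compose: "clinear f \<Longrightarrow> clinear g \<Longrightarrow> clinear (f \<circ> g)"
  by (rule clinearI) (simp_all add: clinear_add clinear_scaleC)

lemma clinear_inv:
  assumes "clinear f" "bij f"
  shows "clinear (inv_into UNIV f)"
proof (rule clinearI)
  fix x y c
  have "f (inv_into UNIV f x + inv_into UNIV f y) = x + y" "f (c *\<^sub>C inv_into UNIV f x) = c *\<^sub>C x"
    using assms by (simp_all add: clinear_add clinear_scaleC bij_is_surj surj_f_inv_f inv_into_f_f)
  then show "inv_into UNIV f (x + y) = inv_into UNIV f x + inv_into UNIV f y" "inv_into UNIV f (c *\<^sub>C x) = c *\<^sub>C inv_into UNIV f x"
    by (metis assms(2) bij_inv_eq_iff)+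
qed

lemma scaleC_complex [simp]: "c *\<^sub>C (z::complex) = c * z"
  by (simp add: scaleC_complex_def)

lemma cinner_clinear: "clinear (cinner (x::'a::complex_inner))"
  by (rule clinearI) (simp_all add: cinner_add_right cinner_scaleC_right)

lemma cinner_sum_right: "cinner x (\<Sum>i\<in>I. f i) = (\<Sum>i\<in>I. cinner x (f i))"
  by (rule clinear_sum [OF cinner_clinear])

lemma cinner_scaleC_left: "cinner (c *\<^sub>C x) y = cnj c * cinner x (y::'a::complex_inner)"
  by (metis cinner_commute cinner_scaleC_right complex_cnj_mult)

lemma cinner_sum_left: "cinner (\<Sum>i\<in>I. f i) y = (\<Sum>i\<in>I. cinner (f i) y)"
  by (subst cinner_commute, simp add: cinner_sum_right flip: cinner_commute)

lemma cinner_zero_right [simp]: "cinner x (0::'a::complex_inner) = 0"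
  by (rule clinear_zero [OF cinner_clinear])

lemma cinner_diff_right: "cinner x (y - z) = cinner x y - cinner x (z::'a::complex_inner)"
  by (metis add_diff_cancel cinner_add_right diff_add_cancel)

lemma cinner_ext:
  assumes "\<And>z. cinner z x = cinner z (y::'a::complex_inner)"
  shows "x = y"
  by (metis assms cinner_diff_right cinner_eq_zero_iff eq_iff_diff_eq_0)

section \<open>Finite frames, adjoints and tensor products\<close>

text \<open>Orthonormal bases satisfy this reconstruction formula; it is the property of them on
  which adjoints and lifts to tensor products rest.\<close>

definition parseval_frame :: "'a::complex_inner set \<Rightarrow> bool" where
  "parseval_frame E \<longleftrightarrow> finite E \<and> (\<forall>x. (\<Sum>e\<in>E. cinner e x *\<^sub>C e) = x)"

lemma frame_finite: "parseval_frame E \<Longrightarrow> finite E"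
  and frame_expand: "parseval_frame E \<Longrightarrow> (\<Sum>e\<in>E. cinner e x *\<^sub>C e) = x"
  by (auto simp: parseval_frame_def)

text \<open>Gram-Schmidt, one generator at a time. Keeping \<open>E\<close> inside the span makes
  every vector orthogonal to the span orthogonal to each frame element.\<close>

lemma span_frame:
  fixes S :: "'a::complex_inner set"
  assumes "finite S"
  shows "\<exists>E. finite E \<and> E \<subseteq> complex_vector.span S \<and>
    (\<forall>x\<in>complex_vector.span S. (\<Sum>e\<in>E. cinner e x *\<^sub>C e) = x)"
  using assms
proof (induction S)
  case empty
  show ?case by (intro exI[of _ "{}"]) auto
next
  case (insert s S)
  then obtain E where E: "finite E" "E \<subseteq> complex_vector.span S"
    "\<And>x. x \<in> complex_vector.span S \<Longrightarrow> (\<Sum>e\<in>E. cinner e x *\<^sub>C e) = x"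
    by auto
  \<comment> \<open>The orthogonal projection of \<open>s\<close> onto the old span;
    \<open>v\<close> below is the residual.\<close>
  define p where "p = (\<Sum>e\<in>E. cinner e s *\<^sub>C e)"
  have p: "p \<in> complex_vector.span S"
    unfolding p_def using E(2)
    by (auto intro!: complex_vector.span_sum complex_vector.span_scale)
  have sub: "complex_vector.span S \<subseteq> complex_vector.span (insert s S)"
    by (rule complex_vector.span_mono) auto
  define v where "v = s - p"
  have v_in: "v \<in> complex_vector.span (insert s S)"
    unfolding v_def using p sub
    by (intro complex_vector.span_diff) (auto intro: complex_vector.span_base)
  \<comment> \<open>Frame expansion is self-adjoint, so it can be moved from \<open>s\<close> to
    \<open>x\<close>, where it is the identity.\<close>
  have orth: "cinner x v = 0" if "x \<in> complex_vector.span S" for x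
  proof -
    have "cinner x p = cinner (\<Sum>e\<in>E. cinner e x *\<^sub>C e) s"
      unfolding p_def cinner_sum_left cinner_sum_right cinner_scaleC_left cinner_scaleC_right
      by (intro sum.cong refl) (metis cinner_commute mult.commute)
    then show ?thesis
      using E(3)[OF that] by (simp add: v_def cinner_diff_right)
  qed
  have decomp: "\<exists>y c. y \<in> complex_vector.span S \<and> x = y + c *\<^sub>C v"
    if "x \<in> complex_vector.span (insert s S)" for x
  proof -
    obtain c where c: "x - c *\<^sub>C s \<in> complex_vector.span S"
      using complex_vector.span_breakdown_eq[of x s S] \<open>x \<in> complex_vector.span (insert s S)\<close> by auto
    have "x = ((x - c *\<^sub>C s) + c *\<^sub>C p) + c *\<^sub>C v"
      by (simp add: v_def complex_vector.scale_right_diff_distrib)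
    then show ?thesis
      using c p complex_vector.span_add complex_vector.span_scale by blast
  qed
  show ?case
  proof (cases "v = 0")
    case True
    then have "\<And>x. x \<in> complex_vector.span (insert s S) \<Longrightarrow> x \<in> complex_vector.span S"
      using decomp by fastforce
    then show ?thesis using E sub by blast
  next
    case False
    define R where "R = Re (cinner v v)"
    have vv: "cinner v v = complex_of_real R"
      unfolding R_def by (metis cinner_commute complex_cnj_cancel_iff of_real_Re Reals_cnj_iff)
    have "R > 0"
      using False vv cinner_ge_zero[of v] cinner_eq_zero_iff[of v] by (auto simp: R_def order_less_le)
    \<comment> \<open>The unit vector along \<open>v\<close>; adding it to \<open>E\<close> adds the
      projection onto the line of \<open>v\<close>.\<close>
    define u where "u = complex_of_real (1 / sqrt R) *\<^sub>C v"
    have uu: "cinner u v *\<^sub>C u = v"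
      using \<open>R > 0\<close> unfolding u_def
      by (simp add: cinner_scaleC_left vv scaleC_scaleC complex_vector.scale_one flip: of_real_mult of_real_divide)
    have ux: "cinner x u = 0" "cinner u x = 0" if "x \<in> complex_vector.span S" for x
      using orth[OF that] unfolding u_def cinner_scaleC_right cinner_scaleC_left
      by (simp, metis cinner_commute complex_cnj_zero mult_zero_right)
    \<comment> \<open>Without this the sum over \<open>insert u E\<close> would not split off the
      term at \<open>u\<close>.\<close>
    have "u \<notin> E"
    proof
      assume "u \<in> E"
      then have "cinner u u = 0" using E(2) ux by blast
      then show False using uu False cinner_eq_zero_iff[of u] by auto
    qed
    have "(\<Sum>e\<in>insert u E. cinner e x *\<^sub>C e) = x" if "x \<in> complex_vector.span (insert s S)" for x
    proof -
      obtain y c where y: "y \<in> complex_vector.span S" and x: "x = y + c *\<^sub>C v"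
        using decomp[OF \<open>x \<in> _\<close>] by blast
      have "(\<Sum>e\<in>E. cinner e x *\<^sub>C e) = (\<Sum>e\<in>E. cinner e y *\<^sub>C e)"
        using E(2) orth by (intro sum.cong) (auto simp: x cinner_add_right cinner_scaleC_right)
      moreover have "cinner u x *\<^sub>C u = c *\<^sub>C v"
        using ux(2)[OF y] uu
        by (simp add: x cinner_add_right cinner_scaleC_right flip: scaleC_scaleC)
      ultimately show ?thesis
        using E(1) E(3)[OF y] \<open>u \<notin> E\<close> x by (simp add: add.commute)
    qed
    moreover have "u \<in> complex_vector.span (insert s S)"
      unfolding u_def using v_in by (rule complex_vector.span_scale)
    ultimately show ?thesis
      using E(1,2) sub by (intro exI[of _ "insert u E"]) auto
  qed
qed

lemma parseval_frame_exists:
  assumes "finite (S::'a::complex_inner set)" "\<And>x. x \<in> complex_vector.span S"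
  shows "\<exists>E::'a set. parseval_frame E"
  using span_frame[OF assms(1)] assms(2) unfolding parseval_frame_def by blast

lemma parseval_frame_complex: "parseval_frame {1::complex}"
  by (simp add: parseval_frame_def cinner_complex_def)

text \<open>\<open>cadjoint\<close> is a choice, so it has the adjoint property once some adjoint
  exists; a frame of the domain supplies one.\<close>

lemma cinner_cadjoint:
  fixes F :: "'a::complex_inner \<Rightarrow> 'b::complex_inner"
  assumes "parseval_frame (E::'a set)" "clinear F"
  shows "cinner (F x) y = cinner x (cadjoint F y)"
proof -
  \<comment> \<open>The frame expansion of the adjoint: its coefficient at \<open>e\<close> has to
    be \<open>cinner (F e) y\<close>.\<close>
  define G where "G y = (\<Sum>e\<in>E. cinner (F e) y *\<^sub>C e)" for y
  have "cinner (F x) y = cinner x (G y)" for x y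
  proof -
    have "F x = (\<Sum>e\<in>E. cinner e x *\<^sub>C F e)"
      by (subst frame_expand[OF assms(1), of x, symmetric])
        (simp only: clinear_sum[OF assms(2)] clinear_scaleC[OF assms(2)])
    then show ?thesis
      unfolding G_def by (simp add: cinner_sum_left cinner_sum_right cinner_scaleC_left
        cinner_scaleC_right mult.commute flip: cinner_commute)
  qed
  then have "\<exists>G. \<forall>x y. cinner (F x) y = cinner x (G y)" by blast
  from someI_ex[OF this] show ?thesis
    unfolding cadjoint_def by blast
qed

lemma clinear_cadjoint:
  fixes F :: "'a::complex_inner \<Rightarrow> 'b::complex_inner"
  assumes "parseval_frame (E::'a set)" "clinear F"
  shows "clinear (cadjoint F)"
  by (rule clinearI; rule cinner_ext)
    (simp_all add: cinner_add_right cinner_scaleC_right flip: cinner_cadjoint[OF assms])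

lemma hilbert_tensor_linear:
  assumes "hilbert_tensor t"
  shows "clinear (t x)" "clinear (\<lambda>x. t x y)"
  using assms by (auto simp: hilbert_tensor_def)

lemma hilbert_tensor_inner:
  "hilbert_tensor t \<Longrightarrow> cinner (t x y) (t x' y') = cinner x x' * cinner y y'"
  by (auto simp: hilbert_tensor_def)

lemma hilbert_tensor_expand:
  assumes "hilbert_tensor t"
  obtains N :: nat and x y where "z = (\<Sum>i<N. t (x i) (y i))"
  using assms unfolding hilbert_tensor_def by metis

lemma hilbert_tensor_unique:
  assumes "hilbert_tensor t" "clinear T" "clinear T'" "\<And>x y. T (t x y) = T' (t x y)"
  shows "T = T'"
proof
  fix z
  obtain N :: nat and x y where "z = (\<Sum>i<N. t (x i) (y i))"
    by (rule hilbert_tensor_expand[OF assms(1)])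
  then show "T z = T' z" by (simp add: clinear_sum assms)
qed

lemma parseval_frame_tensor:
  fixes t :: "'a::complex_inner \<Rightarrow> 'b::complex_inner \<Rightarrow> 'c::complex_inner"
  assumes t: "hilbert_tensor t"
    and E: "parseval_frame (E::'a set)" and F: "parseval_frame (F::'b set)"
  shows "\<exists>G::'c set. parseval_frame G"
proof (rule parseval_frame_exists)
  let ?S = "(\<lambda>(e, f). t e f) ` (E \<times> F)"
  show "finite ?S"
    using E F by (simp add: frame_finite)
  fix z
  obtain N :: nat and x y where z: "z = (\<Sum>i<N. t (x i) (y i))"
    by (rule hilbert_tensor_expand[OF t])
  have "t x y \<in> complex_vector.span ?S" for x y
  proof -
    have "t x y = t (\<Sum>e\<in>E. cinner e x *\<^sub>C e) (\<Sum>f\<in>F. cinner f y *\<^sub>C f)"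
      using E F by (simp add: frame_expand)
    also have "\<dots> = (\<Sum>e\<in>E. cinner e x *\<^sub>C (\<Sum>f\<in>F. cinner f y *\<^sub>C t e f))"
      by (simp add: clinear_sum[OF hilbert_tensor_linear(1)[OF t]]
        clinear_scaleC[OF hilbert_tensor_linear(1)[OF t]]
        clinear_sum[OF hilbert_tensor_linear(2)[OF t]]
        clinear_scaleC[OF hilbert_tensor_linear(2)[OF t]] complex_vector.scale_sum_right
        scaleC_scaleC mult.commute sum.swap[of _ E F])
    also have "\<dots> \<in> complex_vector.span ?S"
      by (intro complex_vector.span_sum complex_vector.span_scale complex_vector.span_base) auto
    finally show ?thesis .
  qed
  then show "z \<in> complex_vector.span ?S"
    unfolding z by (intro complex_vector.span_sum)
qed

text \<open>The universal property of the tensor product, which makes the definite descriptions in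
  \<open>tensor_op\<close> and \<open>gns_mult\<close> meaningful. Uniqueness holds because
  elementary tensors span.\<close>

lemma hilbert_tensor_lift:
  fixes t :: "'a::complex_inner \<Rightarrow> 'b::complex_inner \<Rightarrow> 'c::complex_inner"
  assumes t: "hilbert_tensor t"
    and E: "parseval_frame (E::'a set)" and F: "parseval_frame (F::'b set)"
    and \<beta>: "\<And>x. clinear (\<beta> x)" "\<And>y. clinear (\<lambda>x. \<beta> x y)"
  shows "\<exists>!T. clinear T \<and> (\<forall>x y. T (t x y) = \<beta> x y)"
proof -
  \<comment> \<open>Coefficients are read off by inner products with \<open>t e f\<close>, so no
    decomposition of \<open>z\<close> into elementary tensors is chosen and linearity in
    \<open>z\<close> is immediate.\<close>
  define T where "T z = (\<Sum>e\<in>E. \<Sum>f\<in>F. cinner (t e f) z *\<^sub>C \<beta> e f)" for z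
  have "clinear T"
    by (rule clinearI) (simp_all add: T_def cinner_add_right cinner_scaleC_right scaleC_add_left
      sum.distrib complex_vector.scale_sum_right scaleC_scaleC)
  moreover have "T (t x y) = \<beta> x y" for x y
  proof -
    have "\<beta> x y = \<beta> (\<Sum>e\<in>E. cinner e x *\<^sub>C e) (\<Sum>f\<in>F. cinner f y *\<^sub>C f)"
      using E F by (simp add: frame_expand)
    also have "\<dots> = (\<Sum>f\<in>F. cinner f y *\<^sub>C (\<Sum>e\<in>E. cinner e x *\<^sub>C \<beta> e f))"
      by (simp add: clinear_sum[OF \<beta>(1)] clinear_scaleC[OF \<beta>(1)]
        clinear_sum[OF \<beta>(2)] clinear_scaleC[OF \<beta>(2)])
    also have "\<dots> = T (t x y)"
      by (simp add: T_def hilbert_tensor_inner[OF t] complex_vector.scale_sum_right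
        scaleC_scaleC mult.commute sum.swap[of _ E F])
    finally show ?thesis by simp
  qed
  ultimately have T: "clinear T" "\<And>x y. T (t x y) = \<beta> x y" by auto
  show ?thesis
  proof (rule ex1I[of _ T])
    fix T' assume T': "clinear T' \<and> (\<forall>x y. T' (t x y) = \<beta> x y)"
    show "T' = T"
      by (rule hilbert_tensor_unique[OF t]) (use T T' in simp_all)
  qed (simp add: T)
qed

lemma tensor_op:
  fixes t :: "'a::complex_inner \<Rightarrow> 'b::complex_inner \<Rightarrow> 'c::complex_inner"
  assumes t: "hilbert_tensor t"
    and E: "parseval_frame (E::'a set)" and F: "parseval_frame (F::'b set)"
    and t': "\<And>x. clinear (t' x)" "\<And>y. clinear (\<lambda>x. t' x y)"
    and FG: "clinear f" "clinear g"
  shows "clinear (tensor_op t t' f g)" "tensor_op t t' f g (t x y) = t' (f x) (g y)"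
proof -
  have "\<exists>!T. clinear T \<and> (\<forall>x y. T (t x y) = t' (f x) (g y))"
    using clinear_compose[OF t'(1) FG(2)] clinear_compose[OF t'(2) FG(1)]
    by (intro hilbert_tensor_lift[OF t E F]) (auto simp: o_def)
  from theI'[OF this]
  show "clinear (tensor_op t t' f g)" "tensor_op t t' f g (t x y) = t' (f x) (g y)"
    unfolding tensor_op_def by auto
qed

text \<open>Needed for the factor built from \<open>m\<close>, \<open>\<eta>\<close> and the
  identity, whose domain, the tensor product of the scalars with the GNS space, is modelled by the
  GNS space itself.\<close>

lemma hilbert_tensor_scaleC: "hilbert_tensor (scaleC :: complex \<Rightarrow> 'a \<Rightarrow> 'a::complex_inner)"
proof -
  have "\<exists>(N::nat) c y. z = (\<Sum>i<N. c i *\<^sub>C y i)" for z :: 'a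
    by (intro exI[of _ 1] exI[of _ "\<lambda>_. 1"] exI[of _ "\<lambda>_. z"]) (simp add: scaleC_one)
  then show ?thesis
    unfolding hilbert_tensor_def
    by (auto intro!: clinearI simp: scaleC_add_left scaleC_add_right scaleC_scaleC mult.commute
        cinner_scaleC_left cinner_scaleC_right cinner_complex_def)
qed

section \<open>Functional calculus\<close>

lemma poly_apply_sum:
  assumes "degree p \<le> N"
  shows "poly_apply p (a::'b::fd_cstar_algebra) = (\<Sum>i\<le>N. coeff p i *\<^sub>C a ^ i)"
  unfolding poly_apply_def
  by (rule sum.mono_neutral_left) (use assms in \<open>auto simp: coeff_eq_0\<close>)

lemma poly_apply_add: "poly_apply (p + q) a = poly_apply p a + poly_apply q (a::'b::fd_cstar_algebra)"
proof -
  let ?N = "max (degree p) (degree q)"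
  have "poly_apply (p + q) a = (\<Sum>i\<le>?N. coeff (p + q) i *\<^sub>C a ^ i)"
    by (rule poly_apply_sum) (rule degree_add_le_max)
  then show ?thesis
    by (simp add: poly_apply_sum[of p ?N] poly_apply_sum[of q ?N] scaleC_add_left sum.distrib)
qed

lemma poly_apply_0 [simp]: "poly_apply 0 a = (0::'b::fd_cstar_algebra)"
  by (simp add: poly_apply_def)

lemma poly_apply_pCons:
  "poly_apply (pCons c p) a = c *\<^sub>C 1 + a * poly_apply p (a::'b::fd_cstar_algebra)"
proof -
  have "poly_apply (pCons c p) a = (\<Sum>i\<le>Suc (degree p). coeff (pCons c p) i *\<^sub>C a ^ i)"
    by (rule poly_apply_sum) (rule degree_pCons_le)
  then show ?thesis
    unfolding sum.atMost_Suc_shift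
    by (simp add: poly_apply_def sum_distrib_left mult_scaleC_right)
qed

lemma poly_apply_smult:
  "poly_apply (Polynomial.smult c p) a = c *\<^sub>C poly_apply p (a::'b::fd_cstar_algebra)"
  by (induction p) (simp_all add: poly_apply_pCons scaleC_add_right scaleC_scaleC mult_scaleC_right)

lemma poly_apply_mult:
  "poly_apply (p * q) a = poly_apply p a * poly_apply q (a::'b::fd_cstar_algebra)"
  by (induction p)
    (simp_all add: poly_apply_pCons poly_apply_add poly_apply_smult distrib_right mult_scaleC_left
      scaleC_one mult.assoc)

lemma poly_apply_diff:
  "poly_apply (p - q) a = poly_apply p a - poly_apply q (a::'b::fd_cstar_algebra)"
  using poly_apply_add[of "p - q" q a] by (simp add: algebra_simps)

lemma poly_apply_power: "poly_apply (p ^ k) a = poly_apply p (a::'b::fd_cstar_algebra) ^ k"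
  by (induction k) (simp_all add: poly_apply_mult poly_apply_pCons scaleC_one one_pCons)

lemma poly_apply_1 [simp]: "poly_apply 1 a = (1::'b::fd_cstar_algebra)"
  by (simp add: one_pCons poly_apply_pCons scaleC_one)

lemma poly_apply_sum_poly:
  "poly_apply (\<Sum>i\<in>I. p i) a = (\<Sum>i\<in>I. poly_apply (p i) (a::'b::fd_cstar_algebra))"
  by (induction I rule: infinite_finite_induct) (simp_all add: poly_apply_add)

lemma poly_apply_linear: "poly_apply [:- z, 1:] a = a - z *\<^sub>C (1::'b::fd_cstar_algebra)"
  by (simp add: poly_apply_pCons scaleC_one)

lemma poly_apply_commute:
  "poly_apply p a * poly_apply q a = poly_apply q a * poly_apply p (a::'b::fd_cstar_algebra)"
  by (metis poly_apply_mult mult.commute)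

section \<open>Minimal polynomial, eigenvalues and spectrum\<close>

lemma finite_spanning_set:
  "\<exists>S::'b::fd_cstar_algebra set. finite S \<and> (\<forall>x. x \<in> complex_vector.span S)"
proof -
  obtain S :: "'b set" where "finite S" and S: "\<forall>x. \<exists>c. x = (\<Sum>s\<in>S. c s *\<^sub>C s)"
    using finite_dimensional by auto
  have "x \<in> complex_vector.span S" for x
  proof -
    obtain c where "x = (\<Sum>s\<in>S. c s *\<^sub>C s)" using S by blast
    then show ?thesis
      by (simp add: complex_vector.span_sum complex_vector.span_scale complex_vector.span_base)
  qed
  with \<open>finite S\<close> show ?thesis by blast
qed

lemma annihilating_poly_exists: "\<exists>p. p \<noteq> 0 \<and> poly_apply p (a::'b::fd_cstar_algebra) = 0"
proof (cases "inj (\<lambda>i. a ^ i)")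
  \<comment> \<open>Linear dependence concerns the set of powers, not the sequence, so a repeated
    power is treated apart.\<close>
  case False
  then obtain i j where ij: "a ^ i = a ^ j" "i \<noteq> j" by (auto simp: inj_def)
  have monom: "poly_apply (monom 1 k) a = a ^ k" for k
    by (simp add: monom_altdef poly_apply_power poly_apply_pCons scaleC_one)
  have "monom 1 i - monom 1 j \<noteq> (0::complex poly)"
    using ij by (simp add: monom_eq_iff')
  then show ?thesis
    using ij monom by (intro exI[of _ "monom 1 i - monom 1 j"]) (auto simp: poly_apply_diff)
next
  case inj: True
  obtain S :: "'b set" where S: "finite S" "\<And>x. x \<in> complex_vector.span S"
    using finite_spanning_set by blast
  \<comment> \<open>One more power than \<open>S\<close> has elements, as exponents start at
    \<open>0\<close>; hence a dependence.\<close>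
  let ?P = "(\<lambda>i. a ^ i) ` {..card S}"
  have "card ?P = Suc (card S)"
    using inj by (subst card_image) (auto intro: inj_on_subset)
  then have "complex_vector.dependent ?P"
    using complex_vector.independent_span_bound[of S ?P] S by auto
  then obtain u v where u: "(\<Sum>v\<in>?P. u v *\<^sub>C v) = 0" "v \<in> ?P" "u v \<noteq> 0"
    by (subst (asm) complex_vector.dependent_finite) auto
  define p where "p = (\<Sum>i\<le>card S. monom (u (a ^ i)) i)"
  have c: "coeff p i = (if i \<le> card S then u (a ^ i) else 0)" for i
    by (simp add: p_def coeff_sum coeff_monom if_distrib cong: if_cong)
  have "degree p \<le> card S"
    by (rule degree_le) (simp add: c)
  then have "poly_apply p a = (\<Sum>i\<le>card S. u (a ^ i) *\<^sub>C a ^ i)"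
    by (simp add: poly_apply_sum c)
  also have "\<dots> = (\<Sum>v\<in>?P. u v *\<^sub>C v)"
    using inj by (subst sum.reindex) (auto intro: inj_on_subset)
  finally have "poly_apply p a = 0" using u by simp
  moreover have "p \<noteq> 0"
    using u c by (metis (no_types, lifting) atMost_iff coeff_0 imageE)
  ultimately show ?thesis by blast
qed

lemma star_1 [simp]: "star (1::'b::fd_cstar_algebra) = 1"
  by (metis mult.right_neutral mult_1_left star_mult star_star)

lemma star_diff: "star (x - y) = star x - star (y::'b::fd_cstar_algebra)"
  by (metis add_diff_cancel diff_add_cancel star_add)

lemma star_mult_eq_0: "star x * x = 0 \<Longrightarrow> x = (0::'b::fd_cstar_algebra)"
  by (metis cstar_identity norm_eq_zero zero_eq_power2)

lemma invertible_eigenvector: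
  assumes "invertible_element (x::'b::fd_cstar_algebra)" "x * y = 0"
  shows "y = 0"
proof -
  obtain b where "b * x = 1" using assms(1) by (auto simp: invertible_element_def)
  then have "y = b * (x * y)" by (simp flip: mult.assoc)
  then show ?thesis using assms(2) by simp
qed

text \<open>With \<open>Q = star b * b\<close>, evaluating \<open>\<psi>\<close> at
  \<open>star y * (Q * y)\<close> in two ways shows that \<open>z\<close> is the quotient of
  \<open>\<psi> (star (b * y) * (b * y))\<close> by \<open>\<psi> (star y * y)\<close>, a
  nonnegative real by a positive one. Invertibility of \<open>Q\<close> rules out
  \<open>z = 0\<close>. Eigenvectors are elements of the algebra, on which \<open>Q\<close> acts by
  left multiplication.\<close>

lemma positive_eigenvalue:
  fixes \<psi> :: "'b::fd_cstar_algebra \<Rightarrow> complex" and Q :: 'b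
  assumes \<psi>: "faithful_state \<psi>" and Q: "positive_element Q" "invertible_element Q"
    and y: "(Q - z *\<^sub>C 1) * y = 0" "y \<noteq> 0"
  shows "z \<in> \<real>" "0 < Re z"
proof -
  obtain b where b: "Q = star b * b" using Q by (auto simp: positive_element_def)
  have Qy: "Q * y = z *\<^sub>C y"
    using y(1) by (simp add: left_diff_distrib mult_scaleC_left)
  have lin: "clinear \<psi>" using \<psi> by (simp add: faithful_state_def)
  define s where "s = \<psi> (star y * y)"
  have s: "s \<in> \<real>" "0 \<le> Re s" "s \<noteq> 0"
    using \<psi> y by (auto simp: faithful_state_def s_def)
  define w where "w = \<psi> (star (b * y) * (b * y))"
  have w: "w \<in> \<real>" "0 \<le> Re w"
    using \<psi> by (auto simp: faithful_state_def w_def simp del: star_mult)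
  have "star (b * y) * (b * y) = star y * (Q * y)"
    by (simp add: b star_mult mult.assoc)
  then have "w = z * s"
    using module_hom.scale[OF lin[unfolded linear_iff_module_hom]]
    by (simp add: w_def s_def Qy mult_scaleC_right scaleC_complex_def)
  then have z: "z = w / s" using s by simp
  then show "z \<in> \<real>" using w s by simp
  have "z \<noteq> 0"
    using invertible_eigenvector[OF Q(2)] y Qy by auto
  moreover have "0 \<le> Re z"
    using w s by (auto simp: z elim!: Reals_cases)
  ultimately show "0 < Re z"
    using \<open>z \<in> \<real>\<close> by (auto elim!: Reals_cases)
qed

text \<open>For real \<open>z\<close> the factor \<open>a - z *\<^sub>C 1\<close> is self-adjoint,
  so the hypothesis says that \<open>star w * w = 0\<close> for
  \<open>w = (a - z *\<^sub>C 1) * x\<close>, and the C*-identity applies.\<close>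

lemma self_adjoint_eigen_simple:
  assumes "star a = (a::'b::fd_cstar_algebra)" "z \<in> \<real>"
    and "(a - z *\<^sub>C 1) * ((a - z *\<^sub>C 1) * x) = 0"
  shows "(a - z *\<^sub>C 1) * x = 0"
proof (rule star_mult_eq_0)
  have "star (a - z *\<^sub>C 1) = a - z *\<^sub>C 1"
    using assms(1,2) by (simp add: star_diff star_scaleC Reals_cnj_iff)
  then show "star ((a - z *\<^sub>C 1) * x) * ((a - z *\<^sub>C 1) * x) = 0"
    using assms(3) by (simp add: star_mult mult.assoc)
qed

lemma positive_star: "positive_element Q \<Longrightarrow> star Q = (Q::'b::fd_cstar_algebra)"
  by (auto simp: positive_element_def star_mult star_star)

lemma prod_linear_dvd:
  assumes "finite R" "\<And>z. z \<in> R \<Longrightarrow> poly f z = (0::complex)"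
  shows "(\<Prod>z\<in>R. [:- z, 1:]) dvd f"
  using assms
proof (induction R arbitrary: f)
  case (insert z R)
  then obtain k where k: "f = [:- z, 1:] * k"
    by (metis insertI1 poly_eq_0_iff_dvd dvdE)
  \<comment> \<open>Since \<open>z\<close> is not in \<open>R\<close>, the linear factor is nonzero
    at \<open>w\<close> and the root passes to the quotient.\<close>
  have "poly k w = 0" if "w \<in> R" for w
    using insert.prems[of w] insert.hyps that unfolding k by auto
  then show ?case
    using insert.IH[of k] insert.hyps unfolding k by (simp del: mult_pCons_left add: mult_dvd_mono)
qed simp

text \<open>The spectrum is the set of roots of the minimal polynomial. These roots are simple, because
  a self-adjoint element has no nontrivial generalised eigenvectors.\<close>

lemma spectrum_positive:
  fixes \<psi> :: "'b::fd_cstar_algebra \<Rightarrow> complex" and Q :: 'b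
  assumes \<psi>: "faithful_state \<psi>" and Q: "positive_element Q" "invertible_element Q"
  shows "finite (algebra_spectrum Q)"
    and "\<And>z. z \<in> algebra_spectrum Q \<Longrightarrow> z \<in> \<real> \<and> 0 < Re z"
    and "\<And>p q. (\<And>z. z \<in> algebra_spectrum Q \<Longrightarrow> poly p z = poly q z) \<Longrightarrow>
      poly_apply p Q = poly_apply q Q"
proof -
  \<comment> \<open>A minimal polynomial of \<open>Q\<close>, not normalised to be monic.\<close>
  define g where "g = arg_min degree (\<lambda>p. p \<noteq> 0 \<and> poly_apply p Q = 0)"
  have g: "g \<noteq> 0" "poly_apply g Q = 0"
    and g_min: "\<And>p. p \<noteq> 0 \<Longrightarrow> poly_apply p Q = 0 \<Longrightarrow> degree g \<le> degree p"
    using annihilating_poly_exists[of Q] arg_min_nat_lemma[of "\<lambda>p. p \<noteq> 0 \<and> poly_apply p Q = 0" _ degree]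
    unfolding g_def by blast+
  \<comment> \<open>By minimality the cofactor \<open>k\<close> does not annihilate
    \<open>Q\<close>; its value at \<open>Q\<close> is then an eigenvector for
    \<open>z\<close>.\<close>
  have root: "\<exists>k. g = [:- z, 1:] * k \<and> poly_apply k Q \<noteq> 0" if "poly g z = 0" for z
  proof -
    obtain k where k: "g = [:- z, 1:] * k"
      using \<open>poly g z = 0\<close> by (unfold poly_eq_0_iff_dvd, elim dvdE)
    then have "k \<noteq> 0" using g by auto
    then have "degree g = Suc (degree k)"
      unfolding k by (subst degree_mult_eq) auto
    then have "poly_apply k Q \<noteq> 0" using g_min[of k] \<open>k \<noteq> 0\<close> by auto
    then show ?thesis using k by blast
  qed
  have root_pos: "z \<in> \<real>" "0 < Re z" "z \<in> algebra_spectrum Q" if "poly g z = 0" for z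
  proof -
    obtain k where k: "g = [:- z, 1:] * k" "poly_apply k Q \<noteq> 0" using root[OF \<open>poly g z = 0\<close>] by blast
    have eig: "(Q - z *\<^sub>C 1) * poly_apply k Q = 0"
      using g(2) unfolding k(1) poly_apply_mult poly_apply_linear .
    then show "z \<in> \<real>" "0 < Re z" "z \<in> algebra_spectrum Q"
      using positive_eigenvalue[OF \<psi> Q eig k(2)] invertible_eigenvector[OF _ eig] k(2)
      by (auto simp: algebra_spectrum_def)
  qed
  \<comment> \<open>If \<open>z\<close> is not a root, dividing \<open>g - [:poly g z:]\<close> by
    \<open>[:- z, 1:]\<close> and evaluating at \<open>Q\<close> yields an inverse of
    \<open>Q - z *\<^sub>C 1\<close>.\<close>
  have spec: "poly g z = 0" if z: "z \<in> algebra_spectrum Q" for z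
  proof (rule ccontr)
    assume nz: "poly g z \<noteq> 0"
    obtain k where k: "g - [:poly g z:] = [:- z, 1:] * k"
      using poly_eq_0_iff_dvd[of "g - [:poly g z:]" z] by (auto simp del: mult_pCons_left elim!: dvdE)
    define b where "b = poly_apply (Polynomial.smult (- 1 / poly g z) k) Q"
    have "[:- z, 1:] * Polynomial.smult (- 1 / poly g z) k = 1 - Polynomial.smult (1 / poly g z) g"
      using nz by (simp only: mult_smult_right flip: k) (simp add: smult_diff_right one_pCons)
    then have "(Q - z *\<^sub>C 1) * b = 1"
      unfolding b_def poly_apply_linear[symmetric] poly_apply_mult[symmetric]
      by (simp add: poly_apply_diff poly_apply_smult g)
    moreover have "b * (Q - z *\<^sub>C 1) = (Q - z *\<^sub>C 1) * b"
      unfolding b_def poly_apply_linear[symmetric] by (rule poly_apply_commute)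
    ultimately show False
      using z by (auto simp: algebra_spectrum_def invertible_element_def)
  qed
  have roots: "algebra_spectrum Q = {z. poly g z = 0}"
    using spec root_pos by blast
  then show "finite (algebra_spectrum Q)" using g by (simp add: poly_roots_finite)
  show "\<And>z. z \<in> algebra_spectrum Q \<Longrightarrow> z \<in> \<real> \<and> 0 < Re z" using root_pos roots by blast
  \<comment> \<open>At a double root, \<open>self_adjoint_eigen_simple\<close> would cancel one of
    the two factors, so the cofactor of the other would already annihilate \<open>Q\<close>.\<close>
  have simple: "order z g = 1" if "poly g z = 0" for z
  proof -
    have "\<not> [:- z, 1:] ^ 2 dvd g"
    proof
      assume "[:- z, 1:] ^ 2 dvd g"
      then obtain h where h: "g = [:- z, 1:] * ([:- z, 1:] * h)"
        unfolding power2_eq_square by (metis dvdE mult.assoc)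
      obtain k where k: "g = [:- z, 1:] * k" "poly_apply k Q \<noteq> 0" using root[OF \<open>poly g z = 0\<close>] by blast
      have "[:- z, 1:] * k = [:- z, 1:] * ([:- z, 1:] * h)" using h k(1) by metis
      then have "k = [:- z, 1:] * h" by (subst (asm) mult_left_cancel) auto
      moreover have "(Q - z *\<^sub>C 1) * poly_apply h Q = 0"
        using self_adjoint_eigen_simple[OF positive_star[OF Q(1)] root_pos(1)[OF that], of "poly_apply h Q"] g(2)
        unfolding h poly_apply_mult poly_apply_linear by blast
      ultimately show False using k(2) by (simp add: poly_apply_mult poly_apply_linear del: mult_pCons_left)
    qed
    then show ?thesis
      using order_1[of z g] that g(1) order_root[of g z] power_le_dvd[of "[:- z, 1:]" "order z g" g 2]
      by (metis One_nat_def Suc_1 less_one not_less_eq_eq order_antisym linorder_not_le le_less_Suc_eq)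
  qed
  fix p q :: "complex poly"
  assume pq: "\<And>z. z \<in> algebra_spectrum Q \<Longrightarrow> poly p z = poly q z"
  have "(\<Prod>z\<in>{z. poly g z = 0}. [:- z, 1:]) dvd p - q"
    using pq roots g(1) by (intro prod_linear_dvd) (auto simp: poly_roots_finite)
  \<comment> \<open>As the roots are simple, \<open>g\<close> is up to a scalar the product of its
    distinct linear factors, so agreement on the spectrum means divisibility by
    \<open>g\<close>.\<close>
  moreover have "g = Polynomial.smult (lead_coeff g) (\<Prod>z\<in>{z. poly g z = 0}. [:- z, 1:])"
  proof -
    have "(\<Prod>z\<in>{z. poly g z = 0}. [:- z, 1:] ^ order z g) = (\<Prod>z\<in>{z. poly g z = 0}. [:- z, 1:])"
      by (rule prod.cong) (simp_all add: simple)
    then show ?thesis using complex_poly_decompose[of g] by simp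
  qed
  ultimately have "g dvd p - q"
    using g(1) by (metis smult_dvd leading_coeff_0_iff)
  then obtain k where "p - q = g * k" by (auto elim: dvdE)
  then have "poly_apply (p - q) Q = 0" by (simp add: poly_apply_mult g)
  then show "poly_apply p Q = poly_apply q Q" by (simp add: poly_apply_diff)
qed

section \<open>Interpolation, rules of the calculus and complex powers\<close>

lemma poly_lagrange_poly:
  assumes "finite S" "z \<in> S"
  shows "poly (lagrange_poly S f) z = f z"
proof -
  have "poly (lagrange_poly S f) z = (\<Sum>w\<in>S. f w * (\<Prod>u\<in>S - {w}. (z - u) / (w - u)))"
    by (simp add: lagrange_poly_def poly_sum poly_prod diff_divide_distrib)
  also have "\<dots> = (\<Sum>w\<in>S. if w = z then f z else 0)"
    using assms by (intro sum.cong) (auto intro!: prod.neutral)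
  finally show ?thesis using assms by simp
qed

text \<open>Polynomials that agree on the spectrum have the same value at \<open>Q\<close>, so any
  interpolating polynomial may replace the Lagrange one. The rules below thereby reduce to
  polynomial arithmetic.\<close>

lemma functional_calculus_eqI:
  fixes \<psi> :: "'b::fd_cstar_algebra \<Rightarrow> complex" and Q :: 'b
  assumes "faithful_state \<psi>" "positive_element Q" "invertible_element Q"
    and "\<And>z. z \<in> algebra_spectrum Q \<Longrightarrow> f z = poly p z"
  shows "functional_calculus f Q = poly_apply p Q"
  unfolding functional_calculus_def
  by (rule spectrum_positive(3)[OF assms(1-3)])
    (simp add: poly_lagrange_poly spectrum_positive(1)[OF assms(1-3)] assms(4))

lemma functional_calculus_mult:
  fixes \<psi> :: "'b::fd_cstar_algebra \<Rightarrow> complex" and Q :: 'b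
  assumes "faithful_state \<psi>" "positive_element Q" "invertible_element Q"
  shows "functional_calculus f Q * functional_calculus g Q = functional_calculus (\<lambda>z. f z * g z) Q"
  by (subst functional_calculus_eqI[OF assms, of "\<lambda>z. f z * g z"
        "lagrange_poly (algebra_spectrum Q) f * lagrange_poly (algebra_spectrum Q) g"])
    (simp_all add: poly_lagrange_poly spectrum_positive(1)[OF assms] poly_apply_mult
      functional_calculus_def)

lemma functional_calculus_power:
  fixes \<psi> :: "'b::fd_cstar_algebra \<Rightarrow> complex" and Q :: 'b
  assumes "faithful_state \<psi>" "positive_element Q" "invertible_element Q"
  shows "functional_calculus f Q ^ k = functional_calculus (\<lambda>z. f z ^ k) Q"
  by (subst functional_calculus_eqI[OF assms, of "\<lambda>z. f z ^ k"
        "lagrange_poly (algebra_spectrum Q) f ^ k"])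
    (simp_all add: poly_lagrange_poly spectrum_positive(1)[OF assms] poly_apply_power
      functional_calculus_def)

lemma functional_calculus_ident:
  fixes \<psi> :: "'b::fd_cstar_algebra \<Rightarrow> complex" and Q :: 'b
  assumes "faithful_state \<psi>" "positive_element Q" "invertible_element Q"
  shows "functional_calculus (\<lambda>z. z) Q = Q"
  using functional_calculus_eqI[OF assms, of "\<lambda>z. z" "[:0, 1:]"]
  by (simp add: poly_apply_pCons scaleC_one)

lemma element_cpow_one:
  fixes \<psi> :: "'b::fd_cstar_algebra \<Rightarrow> complex" and Q :: 'b
  assumes "faithful_state \<psi>" "positive_element Q" "invertible_element Q"
  shows "element_cpow Q 1 = Q"
  unfolding element_cpow_def
  using functional_calculus_eqI[OF assms, of "\<lambda>z. z powr 1" "[:0, 1:]"] spectrum_positive(2)[OF assms]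
  by (simp add: poly_apply_pCons scaleC_one)

lemma element_cpow_uminus:
  fixes \<psi> :: "'b::fd_cstar_algebra \<Rightarrow> complex" and Q :: 'b
  assumes "faithful_state \<psi>" "positive_element Q" "invertible_element Q"
  shows "element_cpow Q w * element_cpow Q (- w) = 1"
proof -
  \<comment> \<open>Here the spectrum must avoid \<open>0\<close>, since \<open>0 powr w\<close> is
    \<open>0\<close>.\<close>
  have "z powr w * z powr (- w) = 1" if "z \<in> algebra_spectrum Q" for z
    using spectrum_positive(2)[OF assms that] by (auto simp flip: powr_add)
  then show ?thesis
    unfolding element_cpow_def functional_calculus_mult[OF assms]
    by (subst functional_calculus_eqI[OF assms, of _ 1]) auto
qed

text \<open>\<open>P l\<close> is the Lagrange basis polynomial at \<open>l\<close> evaluated at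
  \<open>Q\<close>; for positive invertible \<open>Q\<close> it is the spectral projection at
  \<open>l\<close>. In these terms two-sided multiplication by functions of \<open>Q\<close> merely
  scales each corner \<open>P l * a * P m\<close>.\<close>

lemma functional_calculus_sandwich:
  fixes Q a :: "'b::fd_cstar_algebra"
  defines "P \<equiv> (\<lambda>z. poly_apply (\<Prod>u\<in>algebra_spectrum Q - {z}.
    Polynomial.smult (1 / (z - u)) [:- u, 1:]) Q)"
  shows "functional_calculus f Q * a * functional_calculus g Q =
    (\<Sum>l\<in>algebra_spectrum Q. \<Sum>m\<in>algebra_spectrum Q. (f l * g m) *\<^sub>C (P l * a * P m))"
proof -
  have "functional_calculus h Q = (\<Sum>l\<in>algebra_spectrum Q. h l *\<^sub>C P l)" for h
    by (simp add: functional_calculus_def lagrange_poly_def poly_apply_sum_poly poly_apply_smult P_def)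
  then show ?thesis
    by (simp only: sum_distrib_right mult_scaleC_left)
      (simp add: sum_distrib_left mult_scaleC_left mult_scaleC_right complex_vector.scale_sum_right
        scaleC_scaleC)
qed

text \<open>Interpolating \<open>z powr w\<close> on the ratios of eigenvalues of \<open>Q\<close> gives the polynomial.\<close>

lemma element_cpow_sandwich:
  fixes \<psi> :: "'b::fd_cstar_algebra \<Rightarrow> complex" and Q :: 'b
  assumes Q: "faithful_state \<psi>" "positive_element Q" "invertible_element Q"
  shows "\<exists>p. \<forall>a. element_cpow Q w * a * element_cpow Q (- w) =
    (\<Sum>i\<le>degree p. coeff p i *\<^sub>C (Q ^ i * a * element_cpow Q (- 1) ^ i))"
proof -
  let ?S = "algebra_spectrum Q"
  \<comment> \<open>Conjugation by \<open>Q\<close> scales the corner at \<open>l\<close>,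
    \<open>m\<close> by \<open>l / m\<close>, so its eigenvalues lie in \<open>K\<close>.\<close>
  define K where "K = (\<lambda>(l, m). l / m) ` (?S \<times> ?S)"
  define p where "p = lagrange_poly K (\<lambda>z. z powr w)"
  have "finite K"
    unfolding K_def using spectrum_positive(1)[OF Q] by simp
  have p: "poly p (l / m) = l powr w * m powr (- w)" if "l \<in> ?S" "m \<in> ?S" for l m
  proof -
    obtain x y where xy: "l = complex_of_real x" "m = complex_of_real y" "0 < x" "0 < y"
      using spectrum_positive(2)[OF Q \<open>l \<in> ?S\<close>] spectrum_positive(2)[OF Q \<open>m \<in> ?S\<close>]
      by (auto elim!: Reals_cases)
    \<comment> \<open>No multiple of \<open>2 * pi * \<i>\<close> appears because both eigenvalues
      are positive reals.\<close>
    have "Ln (l / m) = Ln l - Ln m"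
      using xy by (simp add: Ln_of_real ln_div flip: of_real_divide of_real_diff)
    then have "(l / m) powr w = l powr w * m powr (- w)"
      using xy by (simp add: powr_def right_diff_distrib del: Ln_of_real flip: exp_add)
    moreover have "l / m \<in> K" using that by (auto simp: K_def)
    ultimately show ?thesis
      by (simp add: p_def poly_lagrange_poly \<open>finite K\<close>)
  qed
  have "element_cpow Q w * a * element_cpow Q (- w) =
    (\<Sum>i\<le>degree p. coeff p i *\<^sub>C (Q ^ i * a * element_cpow Q (- 1) ^ i))" for a
  proof -
    define P where "P = (\<lambda>z. poly_apply (\<Prod>u\<in>?S - {z}.
      Polynomial.smult (1 / (z - u)) [:- u, 1:]) Q)"
    have expand: "Q ^ i * a * element_cpow Q (- 1) ^ i =
      (\<Sum>l\<in>?S. \<Sum>m\<in>?S. (l / m) ^ i *\<^sub>C (P l * a * P m))" for i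
    proof -
      have "Q ^ i * a * element_cpow Q (- 1) ^ i =
        functional_calculus (\<lambda>z. z ^ i) Q * a * functional_calculus (\<lambda>z. (z powr (- 1)) ^ i) Q"
        using functional_calculus_power[OF Q, of "\<lambda>z. z" i]
        by (simp add: functional_calculus_ident[OF Q] element_cpow_def functional_calculus_power[OF Q])
      also have "\<dots> = (\<Sum>l\<in>?S. \<Sum>m\<in>?S. (l ^ i * (m powr (- 1)) ^ i) *\<^sub>C (P l * a * P m))"
        unfolding P_def by (rule functional_calculus_sandwich)
      also have "\<dots> = (\<Sum>l\<in>?S. \<Sum>m\<in>?S. (l / m) ^ i *\<^sub>C (P l * a * P m))"
      proof (intro sum.cong refl)
        fix l m assume "m \<in> ?S"
        then have "m \<noteq> 0" using spectrum_positive(2)[OF Q, of m] by auto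
        then show "(l ^ i * (m powr (- 1)) ^ i) *\<^sub>C (P l * a * P m) = (l / m) ^ i *\<^sub>C (P l * a * P m)"
          by (simp add: powr_minus power_mult_distrib power_inverse divide_inverse)
      qed
      finally show ?thesis .
    qed
    have "element_cpow Q w * a * element_cpow Q (- w) =
      (\<Sum>l\<in>?S. \<Sum>m\<in>?S. (l powr w * m powr (- w)) *\<^sub>C (P l * a * P m))"
      unfolding P_def element_cpow_def by (rule functional_calculus_sandwich)
    \<comment> \<open>The scalar on each corner is now the value of \<open>p\<close> at
      \<open>l / m\<close>, and \<open>expand\<close> turns each power of the ratio into an iterated
      conjugation.\<close>
    also have "\<dots> = (\<Sum>l\<in>?S. \<Sum>m\<in>?S. (\<Sum>i\<le>degree p. coeff p i * (l / m) ^ i) *\<^sub>C (P l * a * P m))"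
      by (intro sum.cong refl) (simp flip: p poly_altdef)
    also have "\<dots> = (\<Sum>l\<in>?S. \<Sum>m\<in>?S. \<Sum>i\<le>degree p. coeff p i *\<^sub>C (l / m) ^ i *\<^sub>C (P l * a * P m))"
      by (simp add: complex_vector.scale_sum_left scaleC_scaleC)
    also have "\<dots> = (\<Sum>i\<le>degree p. coeff p i *\<^sub>C (\<Sum>l\<in>?S. \<Sum>m\<in>?S. (l / m) ^ i *\<^sub>C (P l * a * P m)))"
      by (simp add: complex_vector.scale_sum_right sum.swap[of _ "{..degree p}" ?S])
    finally show ?thesis by (simp add: expand)
  qed
  then show ?thesis by blast
qed

section \<open>The GNS space\<close>

lemma block_trace_commute:
  assumes blocks: "matrix_blocks r n \<Phi>"
  shows "block_trace r n \<Phi> (a * b) = block_trace r n \<Phi> (b * a)"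
proof -
  have car: "\<Phi> c k \<in> carrier_mat (n k) (n k)" if "k < r" for c k
  proof -
    have "\<Phi> c \<in> (\<Pi>\<^sub>E k\<in>{..<r}. carrier_mat (n k) (n k))"
      using blocks by (auto simp: matrix_blocks_def bij_betw_def)
    then show ?thesis using that by (auto simp: PiE_def Pi_def)
  qed
  have "\<Phi> (c * d) k $$ (i, i) = (\<Sum>j<n k. \<Phi> c k $$ (i, j) * \<Phi> d k $$ (j, i))"
    if "k < r" "i < n k" for c d k i
    using blocks car[OF that(1), of c] car[OF that(1), of d] that
    by (simp add: matrix_blocks_def scalar_prod_def lessThan_atLeast0)
  then have "(\<Sum>i<n k. \<Phi> (c * d) k $$ (i, i)) = (\<Sum>i<n k. \<Sum>j<n k. \<Phi> c k $$ (i, j) * \<Phi> d k $$ (j, i))"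
    if "k < r" for c d k using that by simp
  note expand = this
  have "(\<Sum>i<n k. \<Phi> (a * b) k $$ (i, i)) = (\<Sum>i<n k. \<Phi> (b * a) k $$ (i, i))" if "k < r" for k
    unfolding expand[OF that] by (subst sum.swap) (simp only: mult.commute)
  then show ?thesis
    by (simp add: block_trace_def)
qed

lemma gns_frame:
  fixes \<Lambda> :: "'b::fd_cstar_algebra \<Rightarrow> 'h::complex_inner"
  assumes "gns_map \<psi> \<Lambda>"
  shows "\<exists>E::'h set. parseval_frame E"
proof -
  have lin: "clinear \<Lambda>" and bij: "bij \<Lambda>" using assms by (auto simp: gns_map_def)
  obtain S :: "'b set" where S: "finite S" "\<And>x. \<exists>c. x = (\<Sum>s\<in>S. c s *\<^sub>C s)"
    using finite_dimensional by auto
  have "z \<in> complex_vector.span (\<Lambda> ` S)" for z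
  proof -
    obtain x where z: "z = \<Lambda> x" using bij by (metis bij_pointE)
    obtain c where "x = (\<Sum>s\<in>S. c s *\<^sub>C s)" using S(2) by blast
    then have "z = (\<Sum>s\<in>S. c s *\<^sub>C \<Lambda> s)"
      unfolding z by (simp add: clinear_sum[OF lin] clinear_scaleC[OF lin])
    then show ?thesis
      by (simp add: complex_vector.span_sum complex_vector.span_scale complex_vector.span_base)
  qed
  then show ?thesis using S(1) by (intro parseval_frame_exists[of "\<Lambda> ` S"]) auto
qed

lemma gns_mult:
  fixes \<Lambda> :: "'b::fd_cstar_algebra \<Rightarrow> 'h::complex_inner"
  assumes gns: "gns_map \<psi> \<Lambda>" and t: "hilbert_tensor t"
  shows "clinear (gns_mult t \<Lambda>)" "gns_mult t \<Lambda> (t (\<Lambda> a) (\<Lambda> b)) = \<Lambda> (a * b)"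
proof -
  obtain E :: "'h set" where E: "parseval_frame E" using gns_frame[OF gns] by blast
  have lin: "clinear \<Lambda>" and bij: "bij \<Lambda>" using gns by (auto simp: gns_map_def)
  let ?V = "inv_into UNIV \<Lambda>"
  have V: "?V (\<Lambda> a) = a" "\<Lambda> (?V x) = x" for a x
    using bij by (simp_all add: bij_is_inj bij_is_surj surj_f_inv_f)
  have linV: "clinear ?V" by (rule clinear_inv[OF lin bij])
  have "\<exists>!T. clinear T \<and> (\<forall>x y. T (t x y) = \<Lambda> (?V x * ?V y))"
    by (rule hilbert_tensor_lift[OF t E E]; rule clinearI)
      (simp_all add: clinear_add[OF linV] clinear_scaleC[OF linV] clinear_add[OF lin]
        clinear_scaleC[OF lin] distrib_left distrib_right mult_scaleC_left mult_scaleC_right)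
  \<comment> \<open>\<open>\<Lambda>\<close> is onto, so the lifted bilinear map satisfies exactly
    the description in \<open>gns_mult\<close>.\<close>
  moreover have "(\<forall>x y. T (t x y) = \<Lambda> (?V x * ?V y)) \<longleftrightarrow> (\<forall>a b. T (t (\<Lambda> a) (\<Lambda> b)) = \<Lambda> (a * b))" for T
  proof (intro iffI allI)
    fix x y assume "\<forall>a b. T (t (\<Lambda> a) (\<Lambda> b)) = \<Lambda> (a * b)"
    from this[rule_format, of "?V x" "?V y"] show "T (t x y) = \<Lambda> (?V x * ?V y)"
      by (simp add: V)
  qed (simp add: V)
  ultimately have "\<exists>!T. clinear T \<and> (\<forall>a b. T (t (\<Lambda> a) (\<Lambda> b)) = \<Lambda> (a * b))" by simp
  from theI'[OF this]
  show "clinear (gns_mult t \<Lambda>)" "gns_mult t \<Lambda> (t (\<Lambda> a) (\<Lambda> b)) = \<Lambda> (a * b)"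
    unfolding gns_mult_def by auto
qed

text \<open>The vectors come from writing the adjoint of multiplication at
  \<open>\<Lambda> 1\<close> as a sum of tensors \<open>t (u i) (v i)\<close>. The first identity
  tests this sum against \<open>t (\<Lambda> a) (\<Lambda> b)\<close>; the second follows
  \<open>x\<close> through the three factors of the undirectedness equation.\<close>

lemma undirected_expand:
  fixes \<Lambda> :: "'b::fd_cstar_algebra \<Rightarrow> 'h::complex_inner"
    and t :: "'h \<Rightarrow> 'h \<Rightarrow> 'h2::complex_inner"
    and tl :: "'h2 \<Rightarrow> 'h \<Rightarrow> 'h3::complex_inner" and tr :: "'h \<Rightarrow> 'h2 \<Rightarrow> 'h3"
  assumes gns: "gns_map \<psi> \<Lambda>"
    and tensor: "hilbert_tensor t" "hilbert_tensor tl" "hilbert_tensor tr"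
      "\<And>x y z. tl (t x y) z = tr x (t y z)"
    and A: "clinear A"
    and undirected:
      "tensor_op tr (\<lambda>x c. c *\<^sub>C x) id (cadjoint (gns_unit \<Lambda>) \<circ> gns_mult t \<Lambda>) \<circ>
       tensor_op tr tr id (tensor_op t t A id) \<circ>
       tensor_op scaleC tl (cadjoint (gns_mult t \<Lambda>) \<circ> gns_unit \<Lambda>) id = A"
  obtains N :: nat and u v where
    "\<And>a b. (\<Sum>i<N. cinner (\<Lambda> a) (u i) * cinner (\<Lambda> b) (v i)) = cinner (\<Lambda> (a * b)) (\<Lambda> 1)"
    "\<And>x. A x = (\<Sum>i<N. cinner (\<Lambda> 1) (gns_mult t \<Lambda> (t (A (v i)) x)) *\<^sub>C u i)"
proof -
  obtain E :: "'h set" where E: "parseval_frame E" using gns_frame[OF gns] by blast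
  obtain G :: "'h2 set" where G: "parseval_frame G"
    using parseval_frame_tensor[OF tensor(1) E E] by blast
  let ?m = "gns_mult t \<Lambda>" and ?e = "gns_unit \<Lambda>"
  note m = gns_mult[OF gns tensor(1)]
  have e: "clinear ?e"
    by (rule clinearI) (simp_all add: gns_unit_def scaleC_add_left scaleC_scaleC)
  note C = parseval_frame_complex
  have e_adj: "cadjoint ?e x = cinner (\<Lambda> 1) x" for x
    using cinner_cadjoint[OF C e, of 1 x]
    by (simp add: gns_unit_def scaleC_one cinner_complex_def)
  note lin = clinear_id clinear_compose clinear_cadjoint[OF G m(1)] clinear_cadjoint[OF C e] e m(1) A
  have sc: "clinear (\<lambda>c. c *\<^sub>C x)" "clinear ((\<lambda>x c. c *\<^sub>C x) x)" "clinear (\<lambda>x. (\<lambda>x c. c *\<^sub>C x) x c)"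
    for x :: 'h and c
    by (rule clinearI; simp add: scaleC_add_left scaleC_add_right scaleC_scaleC mult.commute)+
  have AI: "clinear (tensor_op t t A id)" "\<And>x y. tensor_op t t A id (t x y) = t (A x) y"
    using tensor_op[OF tensor(1) E E hilbert_tensor_linear[OF tensor(1)] A clinear_id] by auto
  \<comment> \<open>\<open>T1\<close>, \<open>T2\<close>, \<open>T3\<close> are the factors in their
    order of application.\<close>
  define T1 where "T1 = tensor_op scaleC tl (cadjoint ?m \<circ> ?e) id"
  have T1: "T1 (c *\<^sub>C x) = tl ((cadjoint ?m \<circ> ?e) c) (id x)" for c x
    unfolding T1_def
    by (rule tensor_op(2)[OF hilbert_tensor_scaleC C E hilbert_tensor_linear[OF tensor(2)]])
      (intro lin)+
  define T2 where "T2 = tensor_op tr tr id (tensor_op t t A id)"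
  have T2: "clinear T2" "T2 (tr x z) = tr (id x) (tensor_op t t A id z)" for x z
    unfolding T2_def
    by (rule tensor_op[OF tensor(3) E G hilbert_tensor_linear[OF tensor(3)] clinear_id AI(1)])+
  define T3 where "T3 = tensor_op tr (\<lambda>x c. c *\<^sub>C x) id (cadjoint ?e \<circ> ?m)"
  have T3: "clinear T3" "T3 (tr x z) = (cadjoint ?e \<circ> ?m) z *\<^sub>C id x" for x z
    unfolding T3_def
    using tensor_op[OF tensor(3) E G sc(2) sc(3) clinear_id clinear_compose[OF lin(4) m(1)]]
    by auto
  obtain N :: nat and u v where uv: "cadjoint ?m (\<Lambda> 1) = (\<Sum>i<N. t (u i) (v i))"
    by (rule hilbert_tensor_expand[OF tensor(1)])
  show thesis
  proof
    fix a b
    have "cinner (\<Lambda> (a * b)) (\<Lambda> 1) = cinner (t (\<Lambda> a) (\<Lambda> b)) (cadjoint ?m (\<Lambda> 1))"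
      by (simp add: m(2) flip: cinner_cadjoint[OF G m(1)])
    then show "(\<Sum>i<N. cinner (\<Lambda> a) (u i) * cinner (\<Lambda> b) (v i)) = cinner (\<Lambda> (a * b)) (\<Lambda> 1)"
      by (simp add: uv cinner_sum_right hilbert_tensor_inner[OF tensor(1)])
  next
    fix x
    \<comment> \<open>The vector \<open>x\<close> is read as \<open>1 *\<^sub>C x\<close>, and
      associativity rebrackets the triple tensors for \<open>T2\<close>.\<close>
    have "T1 x = (\<Sum>i<N. tr (u i) (t (v i) x))"
      using T1[of 1 x]
      by (simp add: scaleC_one gns_unit_def uv clinear_sum[OF hilbert_tensor_linear(2)[OF tensor(2)]]
          tensor(4))
    then have "T3 (T2 (T1 x)) = (\<Sum>i<N. cinner (\<Lambda> 1) (?m (t (A (v i)) x)) *\<^sub>C u i)"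
      by (simp add: clinear_sum[OF T2(1)] clinear_sum[OF T3(1)] T2(2) T3(2) AI(2) e_adj)
    moreover have "T3 (T2 (T1 x)) = A x"
      using fun_cong[OF undirected, of x] by (simp add: T1_def T2_def T3_def)
    ultimately show "A x = (\<Sum>i<N. cinner (\<Lambda> 1) (?m (t (A (v i)) x)) *\<^sub>C u i)" by simp
  qed
qed

text \<open>Pure algebra with \<open>R\<close> the inverse of \<open>Q\<close>: the trace enters
  only through \<open>kms\<close>, and \<open>und\<close> is the undirectedness equation paired with
  \<open>y\<close>. Comparing \<open>und\<close> with \<open>kms\<close> gives that \<open>C\<close>
  commutes with \<open>T\<close>.\<close>

lemma undirected_commutes:
  fixes \<psi> :: "'b::fd_cstar_algebra \<Rightarrow> complex" and Q R :: 'b and C :: "'b \<Rightarrow> 'b"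
  assumes inv: "Q * R = 1" "R * Q = 1" and star: "star Q = Q" "star R = R"
    and kms: "\<And>a b. \<psi> (a * b) = \<psi> (R * b * Q * a)"
    and herm: "\<And>a. \<psi> (star a) = cnj (\<psi> a)"
    and ext: "\<And>x y. (\<And>z. \<psi> (star z * x) = \<psi> (star z * y)) \<Longrightarrow> x = y"
    and sa: "\<And>a b. \<psi> (star (C a) * b) = \<psi> (star a * C b)"
    and und: "\<And>x y. \<psi> (star y * C x) = \<psi> (star (C (Q * star x * R)) * star y)"
  shows "C (star x) = star (C x)" "C (Q * x * R) = Q * C x * R"
proof -
  define T where "T x = Q * star x * R" for x
  have QR [simp]: "Q * (R * x) = x" "R * (Q * x) = x" for x
    by (simp_all add: inv flip: mult.assoc)
  have TT: "T (T x) = x" for x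
    by (simp add: T_def star_mult star star_star mult.assoc inv)
  have star_T: "star (T x) = R * x * Q" for x
    by (simp add: T_def star_mult star star_star mult.assoc)
  have "C x = T (C (T x))" for x
  proof (rule ext)
    fix z
    have "\<psi> (star z * T (C (T x))) = \<psi> (star (C (T x)) * star z)"
      by (subst kms) (simp add: T_def inv mult.assoc)
    then show "\<psi> (star z * C x) = \<psi> (star z * T (C (T x)))"
      by (simp add: und T_def)
  qed
  then have CT: "C (T x) = T (C x)" for x by (metis TT)
  \<comment> \<open>The KMS relation brings \<open>z\<close> to the front as
    \<open>star (T z)\<close>. There \<open>C\<close> can be moved across by self-adjointness and
    past \<open>T\<close>, and the KMS relation brings \<open>C z\<close> back.\<close>
  have CS: "C (star x) = star (C x)" for x
  proof (rule ext)
    fix z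
    have "\<psi> (C x * z) = \<psi> (star (T z) * C x)"
      by (subst kms) (simp add: star_T)
    also have "\<dots> = \<psi> (star (T (C z)) * x)"
      by (simp add: CT flip: sa)
    also have "\<dots> = \<psi> (x * C z)"
      by (subst kms[of x]) (simp add: star_T)
    finally have "\<psi> (star (C x * z)) = \<psi> (star (x * C z))"
      by (simp add: herm)
    then show "\<psi> (star z * C (star x)) = \<psi> (star z * star (C x))"
      by (simp add: star_mult sa)
  qed
  then show "C (star x) = star (C x)" .
  \<comment> \<open>The modular operator is \<open>T\<close> after \<open>star\<close>, and
    \<open>C\<close> commutes with both.\<close>
  have "Q * y * R = T (star y)" for y by (simp add: T_def star_star)
  then show "C (Q * x * R) = Q * C x * R"
    by (simp add: CT CS)
qed

theorem proposition5p23: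
  fixes r :: nat and n :: "nat \<Rightarrow> nat"
    and \<Phi> :: "'b::fd_cstar_algebra \<Rightarrow> nat \<Rightarrow> complex mat"
    and \<psi> :: "'b \<Rightarrow> complex" and Q :: 'b
    and \<Lambda> :: "'b \<Rightarrow> 'h::complex_inner"
    and t :: "'h \<Rightarrow> 'h \<Rightarrow> 'h2::complex_inner"
    and tl :: "'h2 \<Rightarrow> 'h \<Rightarrow> 'h3::complex_inner"
    and tr :: "'h \<Rightarrow> 'h2 \<Rightarrow> 'h3"
    and A :: "'h \<Rightarrow> 'h"
  assumes blocks: "matrix_blocks r n \<Phi>"
    and state: "faithful_state \<psi>"
    and Q: "positive_element Q" "invertible_element Q"
      "\<And>a. \<psi> a = block_trace r n \<Phi> (Q * a)"
    and gns: "gns_map \<psi> \<Lambda>"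
    and tensor: "hilbert_tensor t" "hilbert_tensor tl" "hilbert_tensor tr"
      "\<And>x y z. tl (t x y) z = tr x (t y z)"
    and A: "clinear A" "cadjoint A = A"
    and schur:
      "gns_mult t \<Lambda> \<circ> tensor_op t t A A \<circ> cadjoint (gns_mult t \<Lambda>) = A"
    and undirected:
      "tensor_op tr (\<lambda>x c. c *\<^sub>C x) id (cadjoint (gns_unit \<Lambda>) \<circ> gns_mult t \<Lambda>) \<circ>
       tensor_op tr tr id (tensor_op t t A id) \<circ>
       tensor_op scaleC tl (cadjoint (gns_mult t \<Lambda>) \<circ> gns_unit \<Lambda>) id = A"
  shows "A \<circ> modular_operator Q \<Lambda> = modular_operator Q \<Lambda> \<circ> A \<and>
         A \<circ> modular_conjugation Q \<Lambda> = modular_conjugation Q \<Lambda> \<circ> A"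
proof -
  have lin: "clinear \<Lambda>" and bij: "bij \<Lambda>" and ip: "\<And>a b. cinner (\<Lambda> a) (\<Lambda> b) = \<psi> (star a * b)"
    using gns by (auto simp: gns_map_def)
  let ?V = "inv_into UNIV \<Lambda>"
  have V [simp]: "?V (\<Lambda> a) = a" "\<Lambda> (?V x) = x" for a x
    using bij by (simp_all add: bij_is_inj bij_is_surj surj_f_inv_f)
  define C where "C = ?V \<circ> A \<circ> \<Lambda>"
  have C: "A (\<Lambda> a) = \<Lambda> (C a)" for a by (simp add: C_def)
  have linC: "clinear C"
    unfolding C_def by (intro clinear_compose clinear_inv lin bij A)
  define R where "R = element_cpow Q (- 1)"
  note fc = state Q(1,2)
  have inv: "Q * R = 1"
    using element_cpow_uminus[OF fc, of 1] by (simp add: R_def element_cpow_one[OF fc])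
  have inv': "R * Q = 1"
    using element_cpow_uminus[OF fc, of "- 1"] by (simp add: R_def element_cpow_one[OF fc])
  have starQ: "star Q = Q" by (rule positive_star[OF Q(1)])
  have starR: "star R = R"
    by (metis inv inv' mult.assoc mult.left_neutral mult.right_neutral starQ star_1 star_mult)
  have tr: "block_trace r n \<Phi> (a * b) = block_trace r n \<Phi> (b * a)" for a b
    by (rule block_trace_commute[OF blocks])
  have kms: "\<psi> (a * b) = \<psi> (R * b * Q * a)" for a b
  proof -
    have "\<psi> (R * b * Q * a) = block_trace r n \<Phi> (Q * R * (b * (Q * a)))"
      by (simp add: Q(3) mult.assoc)
    also have "\<dots> = block_trace r n \<Phi> (Q * (a * b))"
      by (simp add: inv tr[of b] mult.assoc)
    finally show ?thesis by (simp add: Q(3))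
  qed
  \<comment> \<open>Conjugate symmetry of the inner product against
    \<open>\<Lambda> 1\<close>.\<close>
  have herm: "\<psi> (star a) = cnj (\<psi> a)" for a
    using cinner_commute[of "\<Lambda> a" "\<Lambda> 1"] by (simp add: ip)
  have ext: "x = y" if "\<And>z. \<psi> (star z * x) = \<psi> (star z * y)" for x y
  proof -
    have "cinner z (\<Lambda> x) = cinner z (\<Lambda> y)" for z
      using that[of "?V z"] by (simp flip: ip)
    then have "\<Lambda> x = \<Lambda> y" by (rule cinner_ext)
    then show ?thesis by (metis V(1))
  qed
  obtain E :: "'h set" where E: "parseval_frame E" using gns_frame[OF gns] by blast
  have sa: "\<psi> (star (C a) * b) = \<psi> (star a * C b)" for a b
    using cinner_cadjoint[OF E A(1), of "\<Lambda> a" "\<Lambda> b"] by (simp add: A(2) C ip)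
  obtain N :: nat and u v where uv:
    "\<And>a b. (\<Sum>i<N. cinner (\<Lambda> a) (u i) * cinner (\<Lambda> b) (v i)) = cinner (\<Lambda> (a * b)) (\<Lambda> 1)"
    "\<And>x. A x = (\<Sum>i<N. cinner (\<Lambda> 1) (gns_mult t \<Lambda> (t (A (v i)) x)) *\<^sub>C u i)"
    by (rule undirected_expand[OF gns tensor A(1) undirected]) blast
  have und: "\<psi> (star y * C x) = \<psi> (star (C (Q * star x * R)) * star y)" for x y
  proof -
    \<comment> \<open>Via \<open>kms\<close> the factor \<open>x\<close> moves to the left, and
      self-adjointness takes \<open>C\<close> off \<open>v i\<close>. The coefficients then have the
      form in \<open>uv(1)\<close>, which sums them.\<close>
    have "cinner (\<Lambda> 1) (gns_mult t \<Lambda> (t (A (v i)) (\<Lambda> x))) = cinner (\<Lambda> (C (Q * star x * R))) (v i)" for i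
    proof -
      have "cinner (\<Lambda> 1) (gns_mult t \<Lambda> (t (A (v i)) (\<Lambda> x))) = \<psi> (C (?V (v i)) * x)"
        using gns_mult(2)[OF gns tensor(1), of "C (?V (v i))" x] by (simp add: ip flip: C)
      also have "\<dots> = \<psi> (star (Q * star x * R) * C (?V (v i)))"
        by (subst kms) (simp add: star_mult star_star starQ starR mult.assoc)
      also have "\<dots> = cinner (\<Lambda> (C (Q * star x * R))) (\<Lambda> (?V (v i)))"
        unfolding ip sa ..
      finally show ?thesis by simp
    qed
    then have "cinner (\<Lambda> y) (A (\<Lambda> x)) = cinner (\<Lambda> (y * C (Q * star x * R))) (\<Lambda> 1)"
      by (subst uv(2)) (simp add: cinner_sum_right cinner_scaleC_right mult.commute flip: uv(1))
    then show ?thesis by (simp add: C ip star_mult)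
  qed
  note comm = undirected_commutes[OF inv inv' starQ starR kms herm ext sa und]
  \<comment> \<open>At \<open>z = - \<i>\<close> the exponent \<open>\<i> * z\<close> equals
    \<open>1\<close>.\<close>
  have nabla: "modular_operator Q \<Lambda> \<xi> = \<Lambda> (Q * ?V \<xi> * R)" for \<xi>
    by (simp add: modular_operator_def sigma_def element_cpow_one[OF fc] R_def)
  have pow: "C (Q ^ i * x * R ^ i) = Q ^ i * C x * R ^ i" for i x
  proof (induction i)
    case (Suc i)
    have "Q ^ Suc i * y * R ^ Suc i = Q * (Q ^ i * y * R ^ i) * R" for y
      by (simp add: mult.assoc power_commutes)
    then show ?case by (simp only: comm(2) Suc.IH)
  qed simp
  \<comment> \<open>The exponent \<open>\<i> * (\<i> / 2)\<close> is minus one half; this power of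
    conjugation by \<open>Q\<close> becomes a polynomial in it, with which the linear map
    \<open>C\<close> commutes by \<open>pow\<close>.\<close>
  obtain p where p: "\<And>a. sigma Q (\<i> / 2) a = (\<Sum>i\<le>degree p. coeff p i *\<^sub>C (Q ^ i * a * R ^ i))"
    using element_cpow_sandwich[OF fc, of "\<i> * (\<i> / 2)"] by (auto simp: sigma_def R_def)
  have "C (sigma Q (\<i> / 2) a) = sigma Q (\<i> / 2) (C a)" for a
    by (simp add: p clinear_sum[OF linC] clinear_scaleC[OF linC] pow)
  then have J: "C (star (sigma Q (\<i> / 2) a)) = star (sigma Q (\<i> / 2) (C a))" for a
    by (simp add: comm(1))
  have AV: "?V (A \<xi>) = C (?V \<xi>)" for \<xi> by (simp add: C_def)
  show ?thesis
    by (auto simp: fun_eq_iff nabla modular_conjugation_def C AV comm(2) J)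
qed

end
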